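(* Let $\mathcal{H}$ be a real Hilbert space, let $M\subset\mathcal{H}$ be a nonempty set, and let $(x^k)_{k\in\mathbb{N}}\subset\mathcal{H}$ be a sequence that is Fejér* monotone with respect to $M$. Then: (i) $\mathfrak{W}(x^k)_{k\in\mathbb{N}}\neq\emptyset$; (ii) for any $w',w''\in\mathfrak{W}(x^k)_{k\in\mathbb{N}}$, there exists $\alpha\in\mathbb{R}$ such that $M\subset\{y\in\mathcal{H}\mid\langle y,w'-w''\rangle=\alpha\}$; (iii) if $\mathrm{cl}(\mathrm{aff}(M))=\mathcal{H}$, then $(x^k)_{k\in\mathbb{N}}$ converges weakly; (iv) if $(x^k)_{k\in\mathbb{N}}$ converges weakly to some $\bar{x}\in\mathrm{cl}(\mathrm{conv}(M))$, then the scalar sequence $\left(\|x^k-y\|\right)_{k\in\mathbb{N}}$ converges for every $y\in\mathcal{H}$.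
   Context: $\mathbb{N}$ denotes the set of nonnegative integers. Let $\mathcal{H}$ be a real Hilbert space with inner product $\langle\cdot,\cdot\rangle$ and norm $\|\cdot\|$. A sequence $(x^k)_{k\in\mathbb{N}}\subset\mathcal{H}$ is Fejér* monotone with respect to a nonempty set $M\subset\mathcal{H}$ if for every $x\in M$ there exists $N(x)\in\mathbb{N}$ such that $\|x^{k+1}-x\|\le\|x^k-x\|$ for all $k\ge N(x)$. $\mathfrak{W}(x^k)_{k\in\mathbb{N}}$ denotes the set of weak cluster points of the sequence, i.e. the weak limits of its weakly convergent subsequences. $\mathrm{conv}(M)$ is the convex hull of $M$, $\mathrm{aff}(M)=\{\sum_{i=1}^p\lambda_i x_i\mid x_i\in M,\ \lambda_i\in\mathbb{R},\ \sum_{i=1}^p\lambda_i=1,\ p\in\mathbb{N}\}$ is its affine hull, and $\mathrm{cl}(\cdot)$ denotes the (norm) closure. *)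

theory Defs
  imports "HOL-Analysis.Analysis"
begin

text \<open>
  A real Hilbert space is a type of sort \<open>{real_inner, complete_space}\<close>. The weak topology of such
  a space is the initial topology for the functionals \<open>\<lambda>y. y \<bullet> u\<close>, so that weak convergence
  is convergence of all inner products.
\<close>

definition weakly_converges :: "(nat \<Rightarrow> 'a::real_inner) \<Rightarrow> 'a \<Rightarrow> bool"
  where "weakly_converges x w \<longleftrightarrow> (\<forall>u. (\<lambda>k. x k \<bullet> u) \<longlonglongrightarrow> w \<bullet> u)"

definition weak_cluster_points :: "(nat \<Rightarrow> 'a::real_inner) \<Rightarrow> 'a set"
  where "weak_cluster_points x = {w. \<exists>r. strict_mono r \<and> weakly_converges (x \<circ> r) w}"

definition fejer_star_monotone :: "(nat \<Rightarrow> 'a::real_normed_vector) \<Rightarrow> 'a set \<Rightarrow> bool"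
  where "fejer_star_monotone x M \<longleftrightarrow>
    (\<forall>y\<in>M. \<exists>N. \<forall>k\<ge>N. norm (x (Suc k) - y) \<le> norm (x k - y))"

end

theory Submission
  imports Defs
begin

text \<open>
  Expanding the square gives \<open>\<parallel>x k - y\<parallel>\<^sup>2 = \<parallel>x k\<parallel>\<^sup>2 - 2 (x k \<bullet> y) + \<parallel>y\<parallel>\<^sup>2\<close>. Fejer* monotonicity makes
  the left-hand side converge for every \<open>y \<in> M\<close>, since a sequence of norms that is eventually
  nonincreasing converges (\<open>fejer_star_monotone_imp_convergent_norm\<close>); in particular \<open>x\<close> is
  bounded. Subtracting the expansions for two points \<open>y, z \<in> M\<close> cancels the unknown term
  \<open>\<parallel>x k\<parallel>\<^sup>2\<close>, so that \<open>x k \<bullet> (y - z)\<close> converges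
  (\<open>fejer_star_monotone_imp_convergent_inner_diff\<close>).

  The whole argument is about the set of directions \<open>u\<close> along which \<open>x k \<bullet> u\<close> converges. For a
  bounded sequence this set is a closed subspace, and if it is the whole space then the Riesz
  representation theorem turns the limit functional into a weak limit
  (\<open>convergent_inner_imp_weakly_converges\<close>). The four claims follow.

  \<^item> A weak cluster point exists because bounded sequences have weakly convergent subsequences
    (\<open>bounded_imp_weakly_convergent_subsequence\<close>): a diagonal subsequence \<open>y\<close> of \<open>x\<close> has
    convergent inner products with all the \<open>x j\<close>. Its convergence directions contain its own
    terms, as well as everything orthogonal to them, hence all of the space.
  \<^item> Two weak cluster points \<open>w'\<close> and \<open>w''\<close> have the same inner product with \<open>y - z\<close>, namely the
    limit of \<open>x k \<bullet> (y - z)\<close>; that is, \<open>y \<bullet> (w' - w'') = z \<bullet> (w' - w'')\<close>.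
  \<^item> If \<open>M\<close> is affinely dense, the differences of its points generate a dense subspace of
    convergence directions. Hence every direction is one, and \<open>x\<close> converges weakly.
  \<^item> If \<open>x\<close> converges weakly, then \<open>x k \<bullet> y\<close> converges for every \<open>y\<close>, and one point of \<open>M\<close> suffices
    to see that \<open>\<parallel>x k\<parallel>\<^sup>2\<close> converges, and with it \<open>\<parallel>x k - y\<parallel>\<^sup>2\<close>.
\<close>

section \<open>Riesz representation on a closed subspace\<close>

text \<open>
  The representing vector is the minimiser of \<open>u \<mapsto> \<parallel>u\<parallel>\<^sup>2 - 2 L u\<close>: by the parallelogram
  law every minimising sequence is Cauchy, and the first-order condition at the minimiser is the
  claim. Taking a subspace \<open>S\<close> instead of the whole space covers orthogonal projections as well,
  where \<open>L\<close> is the inner product with the vector to be projected.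
\<close>

lemma riesz_representation_on_closed_subspace:
  fixes S :: "'a::{real_inner, complete_space} set" and L :: "'a \<Rightarrow> real"
  assumes S: "subspace S" "closed S"
    and add: "\<And>u v. u \<in> S \<Longrightarrow> v \<in> S \<Longrightarrow> L (u + v) = L u + L v"
    and scale: "\<And>c u. u \<in> S \<Longrightarrow> L (c *\<^sub>R u) = c * L u"
    and bound: "\<And>u. u \<in> S \<Longrightarrow> \<bar>L u\<bar> \<le> B * norm u"
  obtains w where "w \<in> S" "\<And>u. u \<in> S \<Longrightarrow> w \<bullet> u = L u"
proof -
  define f where "f u = u \<bullet> u - 2 * L u" for u
  define m where "m = Inf (f ` S)"
  have f_lower: "- B\<^sup>2 \<le> f u" if "u \<in> S" for u
  proof -
    have "0 \<le> (norm u - B)\<^sup>2" by simp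
    then show ?thesis
      using bound[OF that] by (simp add: f_def power2_norm_eq_inner[symmetric] power2_diff mult.commute)
  qed
  have bdd: "bdd_below (f ` S)"
    using f_lower by (intro bdd_belowI2)
  have m_le: "m \<le> f u" if "u \<in> S" for u
    unfolding m_def using bdd that by (rule cINF_lower)
  have "\<exists>u\<in>S. f u < m + 1 / real (Suc n)" for n
  proof (rule ccontr)
    assume "\<not> ?thesis"
    then have "m + 1 / real (Suc n) \<le> m"
      using subspace_0[OF S(1)] unfolding m_def by (intro cINF_greatest) (auto simp: not_less m_def)
    then show False by simp
  qed
  then obtain s where s: "\<And>n. s n \<in> S" "\<And>n. f (s n) < m + 1 / real (Suc n)"
    by metis
  have parallelogram: "(norm (u - v))\<^sup>2 \<le> 2 * (f u - m) + 2 * (f v - m)" if "u \<in> S" "v \<in> S" for u v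
  proof -
    have mid: "(1/2) *\<^sub>R (u + v) \<in> S"
      using S(1) that by (intro subspace_scale subspace_add)
    have "L ((1/2) *\<^sub>R (u + v)) = (L u + L v) / 2"
      using that S(1) scale[of "u + v" "1/2"] by (simp add: add subspace_add)
    then have "f ((1/2) *\<^sub>R (u + v)) = (u + v) \<bullet> (u + v) / 4 - (L u + L v)"
      unfolding f_def by simp
    also have "\<dots> = (f u + f v) / 2 - (norm (u - v))\<^sup>2 / 4"
      by (simp add: f_def power2_norm_eq_inner inner_diff inner_add inner_commute field_simps)
    finally show ?thesis
      using m_le[OF mid] by (simp add: field_simps)
  qed
  have "Cauchy s"
  proof (rule metric_CauchyI)
    fix e :: real assume e: "0 < e"
    then obtain N where N: "1 / real (Suc N) < e\<^sup>2 / 4"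
      using nat_approx_posE[of "e\<^sup>2 / 4"] by auto
    have "dist (s i) (s j) < e" if ij: "N \<le> i" "N \<le> j" for i j
    proof -
      have near: "f (s k) - m < e\<^sup>2 / 4" if "N \<le> k" for k
      proof -
        have "1 / real (Suc k) \<le> 1 / real (Suc N)"
          using that by (intro divide_left_mono) auto
        then show ?thesis using s(2)[of k] N by linarith
      qed
      have "(norm (s i - s j))\<^sup>2 < e\<^sup>2"
        using parallelogram[OF s(1) s(1), of i j] near[OF ij(1)] near[OF ij(2)] by argo
      then show ?thesis
        using e by (simp add: dist_norm power2_less_imp_less)
    qed
    then show "\<exists>N. \<forall>i\<ge>N. \<forall>j\<ge>N. dist (s i) (s j) < e" by blast
  qed
  then obtain w where w: "s \<longlonglongrightarrow> w"
    by (auto simp: Cauchy_convergent_iff convergent_def)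
  have wS: "w \<in> S"
    using S(2) s(1) w by (rule closed_sequentially)
  have L_diff: "L (u - v) = L u - L v" if "u \<in> S" "v \<in> S" for u v
    using add[of "u - v" v] that S(1) by (simp add: subspace_diff)
  have "(\<lambda>n. L (s n) - L w) \<longlonglongrightarrow> 0"
  proof (rule Lim_null_comparison)
    show "\<forall>\<^sub>F n in sequentially. norm (L (s n) - L w) \<le> B * norm (s n - w)"
      using bound[of "s n - w" for n] s(1) wS S(1) by (simp add: L_diff subspace_diff)
    show "(\<lambda>n. B * norm (s n - w)) \<longlonglongrightarrow> 0"
      using w by (intro tendsto_mult_right_zero tendsto_norm_zero) (simp add: LIM_zero_iff)
  qed
  then have "(\<lambda>n. L (s n)) \<longlonglongrightarrow> L w"
    by (simp add: LIM_zero_iff)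
  then have f_lim: "(\<lambda>n. f (s n)) \<longlonglongrightarrow> f w"
    unfolding f_def using w by (intro tendsto_intros)
  have "(\<lambda>n. m + 1 / real (Suc n)) \<longlonglongrightarrow> m + 0"
    using LIMSEQ_inverse_real_of_nat by (intro tendsto_intros) (simp add: inverse_eq_divide)
  then have fw: "f w \<le> m"
    using LIMSEQ_le[OF f_lim] s(2) by (fastforce intro: less_imp_le)
  have "w \<bullet> u = L u" if u: "u \<in> S" for u
  proof (rule ccontr)
    assume ne: "w \<bullet> u \<noteq> L u"
    define d where "d = w \<bullet> u - L u"
    have var: "0 \<le> t\<^sup>2 * (u \<bullet> u) + 2 * t * d" for t
    proof -
      have "f w \<le> f (w + t *\<^sub>R u)"
        using fw m_le[of "w + t *\<^sub>R u"] wS u S(1) by (simp add: subspace_add subspace_scale)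
      also have "\<dots> = f w + t\<^sup>2 * (u \<bullet> u) + 2 * t * d"
        using wS u S(1)
        by (simp add: f_def d_def add scale subspace_scale inner_add inner_commute power2_eq_square algebra_simps)
      finally show ?thesis by simp
    qed
    have upos: "0 < u \<bullet> u"
      using ne add[of 0 0] subspace_0[OF S(1)] by auto
    \<comment> \<open>The step that minimises the quadratic \<open>t\<^sup>2 (u \<bullet> u) + 2 t d\<close>, with minimum \<open>- d\<^sup>2 / (u \<bullet> u)\<close>.\<close>
    have "(- d / (u \<bullet> u))\<^sup>2 * (u \<bullet> u) + 2 * (- d / (u \<bullet> u)) * d = - (d\<^sup>2 / (u \<bullet> u))"
      using upos by (simp add: power2_eq_square field_simps)
    moreover have "0 < d\<^sup>2 / (u \<bullet> u)"
      using ne upos by (simp add: d_def)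
    ultimately show False
      using var[of "- d / (u \<bullet> u)"] by linarith
  qed
  with wS show ?thesis by (rule that)
qed

section \<open>Directions of weak convergence\<close>

lemma subspace_convergent_inner:
  fixes y :: "nat \<Rightarrow> 'a::real_inner"
  shows "subspace {u. convergent (\<lambda>k. y k \<bullet> u)}"
  by (rule subspaceI)
    (auto simp: inner_add_right convergent_const intro: convergent_add convergent_mult)

text \<open>
  Boundedness makes the functionals \<open>u \<mapsto> y k \<bullet> u\<close> uniformly Lipschitz, so that the Cauchy property
  passes from directions near \<open>u\<close> to \<open>u\<close>.
\<close>

lemma closed_convergent_inner:
  fixes y :: "nat \<Rightarrow> 'a::real_inner"
  assumes "bounded (range y)"
  shows "closed {u. convergent (\<lambda>k. y k \<bullet> u)}"
proof -
  obtain B where B: "0 < B" "\<And>k. norm (y k) \<le> B"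
    using assms by (auto simp: bounded_pos)
  have "convergent (\<lambda>k. y k \<bullet> u)" if u: "u \<in> closure {u. convergent (\<lambda>k. y k \<bullet> u)}" for u
  proof -
    have "Cauchy (\<lambda>k. y k \<bullet> u)"
    proof (rule CauchyI)
      fix e :: real assume e: "0 < e"
      then have "0 < e / (3 * B)" using B(1) by simp
      then obtain v where v: "convergent (\<lambda>k. y k \<bullet> v)" "dist v u < e / (3 * B)"
        using u by (auto simp: closure_approachable)
      have near: "\<bar>y k \<bullet> u - y k \<bullet> v\<bar> < e / 3" for k
      proof -
        have "\<bar>y k \<bullet> u - y k \<bullet> v\<bar> \<le> norm (y k) * norm (u - v)"
          using Cauchy_Schwarz_ineq2[of "y k" "u - v"] by (simp add: inner_diff_right)
        also have "\<dots> \<le> B * norm (u - v)"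
          using B(2) by (rule mult_right_mono) simp
        also have "\<dots> < e / 3"
          using v(2) B(1) by (simp add: dist_norm norm_minus_commute field_simps)
        finally show ?thesis .
      qed
      from v(1) have "Cauchy (\<lambda>k. y k \<bullet> v)"
        by (rule convergent_Cauchy)
      then obtain N where N: "\<And>i j. N \<le> i \<Longrightarrow> N \<le> j \<Longrightarrow> \<bar>y i \<bullet> v - y j \<bullet> v\<bar> < e / 3"
        using CauchyD[of "\<lambda>k. y k \<bullet> v" "e / 3"] e by (metis real_norm_def divide_pos_pos zero_less_numeral)
      have "norm (y i \<bullet> u - y j \<bullet> u) < e" if "N \<le> i" "N \<le> j" for i j
        using N[OF that] near[of i] near[of j] unfolding real_norm_def by argo
      then show "\<exists>N. \<forall>i\<ge>N. \<forall>j\<ge>N. norm (y i \<bullet> u - y j \<bullet> u) < e" by blast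
    qed
    then show ?thesis by (rule Cauchy_convergent)
  qed
  then show ?thesis
    using closure_subset_eq by blast
qed

lemma convergent_inner_imp_weakly_converges:
  fixes y :: "nat \<Rightarrow> 'a::{real_inner, complete_space}"
  assumes "bounded (range y)" and conv: "\<And>u. convergent (\<lambda>k. y k \<bullet> u)"
  shows "\<exists>w. weakly_converges y w"
proof -
  obtain B where B: "\<And>k. norm (y k) \<le> B"
    using assms(1) by (auto simp: bounded_iff)
  define L where "L u = lim (\<lambda>k. y k \<bullet> u)" for u
  have L: "(\<lambda>k. y k \<bullet> u) \<longlonglongrightarrow> L u" for u
    using conv[of u] by (simp add: L_def convergent_LIMSEQ_iff)
  have "L (u + v) = L u + L v" for u v
    using tendsto_add[OF L[of u] L[of v]] L[of "u + v"]
    by (intro LIMSEQ_unique) (simp_all add: inner_add_right)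
  moreover have "L (c *\<^sub>R u) = c * L u" for c u
    using tendsto_mult_left[OF L[of u], of c] L[of "c *\<^sub>R u"]
    by (intro LIMSEQ_unique) simp_all
  moreover have "\<bar>L u\<bar> \<le> B * norm u" for u
  proof (rule LIMSEQ_le_const2)
    show "(\<lambda>k. \<bar>y k \<bullet> u\<bar>) \<longlonglongrightarrow> \<bar>L u\<bar>"
      using L by (rule tendsto_rabs)
    have "\<bar>y k \<bullet> u\<bar> \<le> B * norm u" for k
      using Cauchy_Schwarz_ineq2[of "y k" u] mult_right_mono[OF B norm_ge_zero, of k u] by linarith
    then show "\<exists>N. \<forall>k\<ge>N. \<bar>y k \<bullet> u\<bar> \<le> B * norm u" by blast
  qed
  ultimately obtain w where w: "\<And>u. w \<bullet> u = L u"
    using riesz_representation_on_closed_subspace[of UNIV L B] by (metis UNIV_I closed_UNIV subspace_UNIV)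
  then show ?thesis
    using L unfolding weakly_converges_def w[symmetric] by blast
qed

section \<open>Weak sequential compactness of bounded sets\<close>

text \<open>
  Directions orthogonal to the sequence are trivially convergence directions, so testing against
  the terms of the sequence itself is enough: any \<open>u\<close> can be replaced by its orthogonal projection
  \<open>p\<close> onto the closed subspace of convergence directions.
\<close>

lemma convergent_inner_terms_imp_convergent_inner:
  fixes y :: "nat \<Rightarrow> 'a::{real_inner, complete_space}"
  assumes "bounded (range y)" and terms: "\<And>j. convergent (\<lambda>k. y k \<bullet> y j)"
  shows "convergent (\<lambda>k. y k \<bullet> u)"
proof -
  let ?C = "{u. convergent (\<lambda>k. y k \<bullet> u)}"
  have bound: "\<bar>u \<bullet> v\<bar> \<le> norm u * norm v" for v
    by (rule Cauchy_Schwarz_ineq2)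
  obtain p where p: "p \<in> ?C" "\<And>v. v \<in> ?C \<Longrightarrow> p \<bullet> v = u \<bullet> v"
    by (rule riesz_representation_on_closed_subspace
          [OF subspace_convergent_inner closed_convergent_inner[OF assms(1)],
            where L = "\<lambda>v. u \<bullet> v" and B = "norm u"])
      (use bound in \<open>auto simp: inner_add_right\<close>)
  have "y k \<bullet> u = y k \<bullet> p" for k
    using p(2)[of "y k"] terms by (simp add: inner_commute)
  then show ?thesis
    using p(1) by simp
qed

text \<open>
  The diagonal argument is the sequential compactness of a countable product of intervals.
\<close>

lemma bounded_coordinates_imp_convergent_subsequence:
  fixes f :: "nat \<Rightarrow> nat \<Rightarrow> real"
  assumes "\<And>k j. \<bar>f k j\<bar> \<le> b"
  shows "\<exists>r. strict_mono (r :: nat \<Rightarrow> nat) \<and> (\<forall>j. convergent (\<lambda>k. f (r k) j))"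
proof -
  have "compact (PiE UNIV (\<lambda>j::nat. {- b..b}))"
    using compactin_PiE[of "\<lambda>_. euclidean" UNIV "\<lambda>j::nat. {- b..b}"]
    by (simp add: euclidean_product_topology)
  moreover have "f k \<in> PiE UNIV (\<lambda>j::nat. {- b..b})" for k
    using assms by (auto simp: abs_le_iff minus_le_iff)
  ultimately obtain l r where r: "strict_mono (r :: nat \<Rightarrow> nat)" and l: "(f \<circ> r) \<longlonglongrightarrow> l"
    by (metis compact_imp_seq_compact seq_compactE)
  have "(\<lambda>k. (f \<circ> r) k j) \<longlonglongrightarrow> l j" for j
    using continuous_on_tendsto_compose[OF continuous_on_product_coordinates l] by simp
  then show ?thesis
    using r by (auto simp: convergent_def)
qed

theorem bounded_imp_weakly_convergent_subsequence:
  fixes x :: "nat \<Rightarrow> 'a::{real_inner, complete_space}"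
  assumes "bounded (range x)"
  shows "weak_cluster_points x \<noteq> {}"
proof -
  obtain B where B: "0 < B" "\<And>k. norm (x k) \<le> B"
    using assms by (auto simp: bounded_pos)
  have "\<bar>x k \<bullet> x j\<bar> \<le> B * B" for k j
    using B(1) by (intro order_trans[OF Cauchy_Schwarz_ineq2] mult_mono B(2)) simp_all
  then obtain r where r: "strict_mono r" "\<And>j. convergent (\<lambda>k. x (r k) \<bullet> x j)"
    using bounded_coordinates_imp_convergent_subsequence[of "\<lambda>k j. x k \<bullet> x j"] by blast
  have bdd: "bounded (range (x \<circ> r))"
    using assms by (rule bounded_subset) auto
  have "convergent (\<lambda>k. (x \<circ> r) k \<bullet> u)" for u
    using bdd by (rule convergent_inner_terms_imp_convergent_inner) (simp add: r(2))
  then obtain w where "weakly_converges (x \<circ> r) w"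
    using convergent_inner_imp_weakly_converges[OF bdd] by blast
  then show ?thesis
    using r(1) by (auto simp: weak_cluster_points_def)
qed

section \<open>Fejer* monotone sequences\<close>

lemma fejer_star_monotone_imp_convergent_norm:
  assumes "fejer_star_monotone x M" "y \<in> M"
  shows "convergent (\<lambda>k. norm (x k - y))"
proof -
  obtain N where N: "\<And>k. N \<le> k \<Longrightarrow> norm (x (Suc k) - y) \<le> norm (x k - y)"
    using assms by (auto simp: fejer_star_monotone_def)
  have dec: "decseq (\<lambda>k. norm (x (k + N) - y))"
    using N by (intro decseq_SucI) simp
  have "convergent (\<lambda>k. norm (x (k + N) - y))"
    using decseq_convergent[OF dec, of 0] by (auto simp: convergent_def)
  then show ?thesis
    using convergent_ignore_initial_segment[of "\<lambda>k. norm (x k - y)" N] by simp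
qed

lemma fejer_star_monotone_imp_bounded:
  assumes "fejer_star_monotone x M" "M \<noteq> {}"
  shows "bounded (range x)"
proof -
  obtain y where "y \<in> M" using assms(2) by blast
  then have "Bseq (\<lambda>k. norm (x k - y))"
    using assms(1) by (intro convergent_imp_Bseq fejer_star_monotone_imp_convergent_norm)
  then have "bounded (range (\<lambda>k. x k - y))"
    by (simp add: Bseq_eq_bounded bounded_iff)
  then have "bounded ((+) y ` range (\<lambda>k. x k - y))"
    by (rule bounded_translation)
  then show ?thesis
    by (simp add: image_image)
qed

lemma norm_diff_squared_expand:
  fixes a b :: "'a::real_inner"
  shows "(norm (a - b))\<^sup>2 = (norm a)\<^sup>2 - 2 * (a \<bullet> b) + (norm b)\<^sup>2"
  by (simp add: power2_norm_eq_inner inner_diff inner_commute)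

lemma fejer_star_monotone_imp_convergent_inner_diff:
  fixes x :: "nat \<Rightarrow> 'a::real_inner"
  assumes "fejer_star_monotone x M" "y \<in> M" "z \<in> M"
  shows "convergent (\<lambda>k. x k \<bullet> (y - z))"
proof -
  have sq: "convergent (\<lambda>k. (norm (x k - v))\<^sup>2)" if "v \<in> M" for v
    using fejer_star_monotone_imp_convergent_norm[OF assms(1) that] tendsto_power
    unfolding convergent_def by blast
  have "x k \<bullet> (y - z) =
      ((norm (x k - z))\<^sup>2 - (norm (x k - y))\<^sup>2 + ((norm y)\<^sup>2 - (norm z)\<^sup>2)) * (1/2)" for k
    by (simp add: norm_diff_squared_expand inner_diff_right)
  then show ?thesis
    using sq assms(2,3) by (simp only:) (intro convergent_mult convergent_add convergent_diff convergent_const)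
qed

lemma weak_cluster_point_inner_eq_lim:
  assumes "w \<in> weak_cluster_points x" "(\<lambda>k. x k \<bullet> u) \<longlonglongrightarrow> l"
  shows "w \<bullet> u = l"
proof -
  obtain r where r: "strict_mono r" "weakly_converges (x \<circ> r) w"
    using assms(1) by (auto simp: weak_cluster_points_def)
  have "(\<lambda>k. x (r k) \<bullet> u) \<longlonglongrightarrow> l"
    using LIMSEQ_subseq_LIMSEQ[OF assms(2) r(1)] by (simp add: o_def)
  moreover have "(\<lambda>k. x (r k) \<bullet> u) \<longlonglongrightarrow> w \<bullet> u"
    using r(2) by (simp add: weakly_converges_def)
  ultimately show ?thesis
    using LIMSEQ_unique by blast
qed

lemma fejer_star_monotone_imp_hyperplane:
  fixes x :: "nat \<Rightarrow> 'a::real_inner"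
  assumes "fejer_star_monotone x M" "w' \<in> weak_cluster_points x" "w'' \<in> weak_cluster_points x"
  shows "\<exists>\<alpha>. M \<subseteq> {y. y \<bullet> (w' - w'') = \<alpha>}"
proof -
  have "y \<bullet> (w' - w'') = z \<bullet> (w' - w'')" if "y \<in> M" "z \<in> M" for y z
  proof -
    obtain l where "(\<lambda>k. x k \<bullet> (y - z)) \<longlonglongrightarrow> l"
      using fejer_star_monotone_imp_convergent_inner_diff[OF assms(1) \<open>y \<in> M\<close> \<open>z \<in> M\<close>]
      by (auto simp: convergent_def)
    then have "w' \<bullet> (y - z) = w'' \<bullet> (y - z)"
      using assms(2,3) by (simp add: weak_cluster_point_inner_eq_lim)
    then show ?thesis
      by (simp add: inner_diff inner_commute)
  qed
  then show ?thesis by blast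
qed

text \<open>
  Translating the closed subspace of convergence directions by a point of \<open>M\<close> gives a closed affine
  set that contains \<open>M\<close>, and therefore the closed affine hull of \<open>M\<close>.
\<close>

lemma fejer_star_monotone_dense_imp_weakly_converges:
  fixes x :: "nat \<Rightarrow> 'a::{real_inner, complete_space}"
  assumes fejer: "fejer_star_monotone x M" and "M \<noteq> {}"
    and dense: "closure (affine hull M) = UNIV"
  shows "\<exists>w. weakly_converges x w"
proof -
  let ?C = "{u. convergent (\<lambda>k. x k \<bullet> u)}"
  obtain z where z: "z \<in> M" using assms(2) by blast
  have bdd: "bounded (range x)"
    using fejer assms(2) by (rule fejer_star_monotone_imp_bounded)
  have "M \<subseteq> (+) z ` ?C"
  proof
    fix y assume "y \<in> M"
    then have "y - z \<in> ?C"
      using fejer_star_monotone_imp_convergent_inner_diff[OF fejer _ z] by simp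
    then have "z + (y - z) \<in> (+) z ` ?C" by (rule imageI)
    then show "y \<in> (+) z ` ?C" by simp
  qed
  moreover have "affine ((+) z ` ?C)"
    using affine_translation subspace_imp_affine[OF subspace_convergent_inner] by blast
  moreover have "closed ((+) z ` ?C)"
    by (intro closed_translation closed_convergent_inner bdd)
  ultimately have "closure (affine hull M) \<subseteq> (+) z ` ?C"
    by (intro closure_minimal hull_minimal)
  then have everything: "(+) z ` ?C = UNIV"
    using dense by blast
  have "convergent (\<lambda>k. x k \<bullet> u)" for u
  proof -
    have "z + u \<in> (+) z ` ?C" unfolding everything by (rule UNIV_I)
    then show ?thesis by auto
  qed
  then show ?thesis
    by (rule convergent_inner_imp_weakly_converges[OF bdd])
qed

lemma fejer_star_monotone_weakly_converges_imp_convergent_norm: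
  fixes x :: "nat \<Rightarrow> 'a::real_inner"
  assumes "fejer_star_monotone x M" "M \<noteq> {}" "weakly_converges x w"
  shows "convergent (\<lambda>k. norm (x k - y))"
proof -
  obtain z where "z \<in> M" using assms(2) by blast
  then obtain l where "(\<lambda>k. norm (x k - z)) \<longlonglongrightarrow> l"
    using fejer_star_monotone_imp_convergent_norm[OF assms(1)] by (auto simp: convergent_def)
  moreover have "(\<lambda>k. x k \<bullet> u) \<longlonglongrightarrow> w \<bullet> u" for u
    using assms(3) by (simp add: weakly_converges_def)
  ultimately have
    "(\<lambda>k. (norm (x k - z))\<^sup>2 + 2 * (x k \<bullet> (z - y)) + ((norm y)\<^sup>2 - (norm z)\<^sup>2))
      \<longlonglongrightarrow> l\<^sup>2 + 2 * (w \<bullet> (z - y)) + ((norm y)\<^sup>2 - (norm z)\<^sup>2)"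
    by (intro tendsto_add tendsto_power tendsto_mult_left tendsto_const)
  moreover have "(norm (x k - z))\<^sup>2 + 2 * (x k \<bullet> (z - y)) + ((norm y)\<^sup>2 - (norm z)\<^sup>2)
      = (norm (x k - y))\<^sup>2" for k
    by (simp add: norm_diff_squared_expand inner_diff_right)
  ultimately have "(\<lambda>k. sqrt ((norm (x k - y))\<^sup>2))
      \<longlonglongrightarrow> sqrt (l\<^sup>2 + 2 * (w \<bullet> (z - y)) + ((norm y)\<^sup>2 - (norm z)\<^sup>2))"
    by (intro tendsto_real_sqrt) simp
  then show ?thesis
    by (auto simp: convergent_def)
qed

theorem proposition4p4:
  fixes M :: "'a::{real_inner, complete_space} set"
    and x :: "nat \<Rightarrow> 'a"
  assumes "M \<noteq> {}"
    and "fejer_star_monotone x M"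
  shows "weak_cluster_points x \<noteq> {} \<and>
    (\<forall>w'\<in>weak_cluster_points x. \<forall>w''\<in>weak_cluster_points x.
       \<exists>\<alpha>::real. M \<subseteq> {y. y \<bullet> (w' - w'') = \<alpha>}) \<and>
    (closure (affine hull M) = UNIV \<longrightarrow> (\<exists>w. weakly_converges x w)) \<and>
    (\<forall>xbar\<in>closure (convex hull M). weakly_converges x xbar \<longrightarrow>
       (\<forall>y. convergent (\<lambda>k. norm (x k - y))))"
proof (intro conjI ballI impI allI)
  show "weak_cluster_points x \<noteq> {}"
    using fejer_star_monotone_imp_bounded[OF assms(2,1)]
    by (rule bounded_imp_weakly_convergent_subsequence)
next
  fix w' w'' assume "w' \<in> weak_cluster_points x" "w'' \<in> weak_cluster_points x"
  with assms(2) show "\<exists>\<alpha>::real. M \<subseteq> {y. y \<bullet> (w' - w'') = \<alpha>}"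
    by (rule fejer_star_monotone_imp_hyperplane)
next
  assume "closure (affine hull M) = UNIV"
  with assms(2,1) show "\<exists>w. weakly_converges x w"
    by (rule fejer_star_monotone_dense_imp_weakly_converges)
next
  fix xbar y assume "weakly_converges x xbar"
  with assms(2,1) show "convergent (\<lambda>k. norm (x k - y))"
    by (rule fejer_star_monotone_weakly_converges_imp_convergent_norm)
qed

end
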